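(* Let $A$ be a torsion-free commutative unital ring and let $G$ be a finite group. Then $\mathrm{Out}(A[G])=0$. As a consequence, if $A=\mathbb{Z},\mathbb{Q},\mathbb{R}$ or $\mathbb{C}$ (and $G$ is finite), then $\mathrm{Out}(A[G])=0$.
   Context: A ring is torsion-free if its additive group is torsion-free. $A[G]$ is the group ring. $\mathrm{Der}(A[G])$ is the $A$-module of derivations of $A[G]$: $A$-linear maps $d:A[G]\to A[G]$ with $d(xy)=d(x)y+x\,d(y)$ for all $x,y$. For $a\in A[G]$, $\mathrm{ad}_a(x)=ax-xa$; $\mathrm{Inn}(A[G])$ consists of the finite sums $\sum_{a\in G}C_a\,\mathrm{ad}_a$, $C_a\in A$; $\mathrm{Out}(A[G])=\mathrm{Der}(A[G])/\mathrm{Inn}(A[G])$. *)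

theory Defs
  imports
    Complex_Main
    "HOL-Library.Poly_Mapping"
    "HOL-Algebra.Elementary_Groups"
begin

text \<open>
  The group ring \<open>A[G]\<close> is the type \<open>('g, 'a) poly_mapping\<close> of finitely supported functions from
  \<open>'g\<close> to \<open>'a\<close> with the library's convolution product. That product is indexed by an
  additively written monoid, so the group is given by the class \<^class>\<open>group_add\<close>, which does
  \<^emph>\<open>not\<close> assume commutativity. The basis element of a group element \<open>g\<close> is
  \<open>Poly_Mapping.single g 1\<close>.

  The coefficients have sort \<open>{comm_ring, monoid_mult}\<close>, i.e. commutative unital rings, rather
  than \<^class>\<open>comm_ring_1\<close>, because the latter excludes the zero ring.
\<close>

type_synonym ('a, 'g) group_ring = "('g, 'a) poly_mapping"

definition torsion_free :: "'a::ab_group_add itself \<Rightarrow> bool" where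
  "torsion_free _ \<longleftrightarrow> (\<forall>(a::'a) (n::nat). n > 0 \<longrightarrow> (\<Sum>i<n. a) = 0 \<longrightarrow> a = 0)"

definition scale :: "'a \<Rightarrow> ('a::{comm_ring, monoid_mult}, 'g) group_ring \<Rightarrow> ('a, 'g) group_ring" where
  "scale c x = Poly_Mapping.map (\<lambda>b. c * b) x"

lemma lookup_scale: "Poly_Mapping.lookup (scale c x) g = c * Poly_Mapping.lookup x g"
  unfolding scale_def by transfer (simp add: when_def)

definition Der ::
  "(('a::{comm_ring, monoid_mult}, 'g::group_add) group_ring \<Rightarrow> ('a, 'g) group_ring) set" where
  "Der = {d. (\<forall>x y. d (x + y) = d x + d y) \<and>
             (\<forall>c x. d (scale c x) = scale c (d x)) \<and>
             (\<forall>x y. d (x * y) = d x * y + x * d y)}"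

definition ad ::
  "('a::{comm_ring, monoid_mult}, 'g::group_add) group_ring \<Rightarrow> ('a, 'g) group_ring \<Rightarrow> ('a, 'g) group_ring" where
  "ad a x = a * x - x * a"

definition Inn ::
  "(('a::{comm_ring, monoid_mult}, 'g::group_add) group_ring \<Rightarrow> ('a, 'g) group_ring) set" where
  "Inn = {(\<lambda>x. \<Sum>g\<in>S. scale (C g) (ad (Poly_Mapping.single g 1) x)) | (C :: 'g \<Rightarrow> 'a) S. finite S}"

text \<open>The additive group of derivations; its operation is pointwise addition.\<close>

definition Der_group ::
  "(('a::{comm_ring, monoid_mult}, 'g::group_add) group_ring \<Rightarrow> ('a, 'g) group_ring) monoid" where
  "Der_group = \<lparr>carrier = Der, monoid.mult = (\<lambda>d e x. d x + e x), one = (\<lambda>x. 0)\<rparr>"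

text \<open>
  The quotient module \<open>Der(A[G]) / Inn(A[G])\<close> is represented by its underlying additive group: a
  module is zero iff its additive group is trivial, so the scalar action is not recorded.
\<close>

definition Out ::
  "'a::{comm_ring, monoid_mult} itself \<Rightarrow> 'g::group_add itself \<Rightarrow>
    (('a, 'g) group_ring \<Rightarrow> ('a, 'g) group_ring) set monoid" where
  "Out _ _ = Der_group Mod Inn"

lemma scale_0_right [simp]: "scale c 0 = 0"
  by (rule poly_mapping_eqI) (simp add: lookup_scale)

lemma scale_add_right: "scale c (x + y) = scale c x + scale c y"
  by (rule poly_mapping_eqI) (simp add: lookup_scale lookup_add distrib_left)

lemma scale_add_left: "scale (b + c) x = scale b x + scale c x"
  by (rule poly_mapping_eqI) (simp add: lookup_scale lookup_add distrib_right)

lemma scale_minus_left: "scale (- c) x = - scale c x"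
  by (rule poly_mapping_eqI) (simp add: lookup_scale)

lemma scale_minus_right: "scale c (- x) = - scale c x"
  by (rule poly_mapping_eqI) (simp add: lookup_scale)

lemma scale_diff_right: "scale c (x - y) = scale c x - scale c y"
  using scale_add_right[of c x "- y"] by (simp add: scale_minus_right)

lemma scale_scale: "scale b (scale c x) = scale (b * c) x"
  by (rule poly_mapping_eqI) (simp add: lookup_scale mult.assoc)

lemma scale_sum_right: "scale c (sum f S) = (\<Sum>s\<in>S. scale c (f s))"
  by (induction S rule: infinite_finite_induct) (simp_all add: scale_add_right)

lemma scale_eq_single_mult: "scale c x = Poly_Mapping.single 0 c * x"
  by (rule poly_mapping_eqI) (simp add: lookup_scale lookup_mult lookup_single when_mult)

lemma scale_mult_left: "scale c x * y = scale c (x * y)"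
  by (simp add: scale_eq_single_mult mult.assoc)

lemma mult_single_0_commute:
  fixes x :: "('a::{comm_ring, monoid_mult}, 'g::group_add) group_ring"
  shows "x * Poly_Mapping.single 0 c = Poly_Mapping.single 0 c * x"
proof (rule poly_mapping_eqI)
  fix k :: 'g
  have *: "(\<Sum>q. (c when q = 0) when k = l + q) = (c when l = k)" for l :: 'g
  proof -
    have "((c when q = 0) when k = l + q) = ((c when l = k) when q = 0)" for q :: 'g
      by (auto simp: when_def)
    then show ?thesis by simp
  qed
  show "Poly_Mapping.lookup (x * Poly_Mapping.single 0 c) k = Poly_Mapping.lookup (Poly_Mapping.single 0 c * x) k"
    by (simp add: lookup_mult lookup_single when_mult mult_when eq_commute[of 0] * mult.commute)
qed

lemma scale_mult_right:
  fixes x :: "('a::{comm_ring, monoid_mult}, 'g::group_add) group_ring"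
  shows "x * scale c y = scale c (x * y)"
  unfolding scale_eq_single_mult by (simp flip: mult.assoc add: mult_single_0_commute)

lemma derI:
  assumes "\<And>x y. d (x + y) = d x + d y" "\<And>c x. d (scale c x) = scale c (d x)"
    "\<And>x y. d (x * y) = d x * y + x * d y"
  shows "d \<in> Der"
  using assms by (simp add: Der_def)

lemma comm_group_Der_group:
  "comm_group (Der_group :: (('a::{comm_ring, monoid_mult}, 'g::group_add) group_ring \<Rightarrow> _) monoid)"
proof (rule comm_groupI, goal_cases)
  case (6 d)
  then have "(\<lambda>x. - d x) \<in> Der"
    by (auto simp: Der_group_def Der_def scale_minus_right)
  then show ?case
    by (intro bexI[of _ "\<lambda>x. - d x"]) (simp_all add: Der_group_def)
qed (simp_all add: Der_group_def Der_def scale_add_right distrib_left distrib_right ac_simps)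

lemma ad_in_Der: "ad a \<in> Der"
  by (rule derI)
     (simp_all add: ad_def scale_mult_left scale_mult_right scale_diff_right algebra_simps)

lemma scale_in_Der: "d \<in> Der \<Longrightarrow> (\<lambda>x. scale c (d x)) \<in> Der"
  by (auto simp: Der_def scale_add_right scale_scale scale_mult_left scale_mult_right mult.commute[of c])

lemma sum_in_Der: "(\<And>s. s \<in> S \<Longrightarrow> f s \<in> Der) \<Longrightarrow> (\<lambda>x. \<Sum>s\<in>S. f s x) \<in> Der"
  by (auto simp: Der_def scale_sum_right sum_distrib_left sum_distrib_right sum.distrib)

lemma Inn_add:
  fixes d e :: "('a::{comm_ring, monoid_mult}, 'g::group_add) group_ring \<Rightarrow> ('a, 'g) group_ring"
  assumes "d \<in> Inn" "e \<in> Inn"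
  shows "(\<lambda>x. d x + e x) \<in> Inn"
proof -
  obtain C S where d: "finite S" "d = (\<lambda>x. \<Sum>g\<in>S. scale (C g) (ad (Poly_Mapping.single g 1) x))"
    using assms(1) unfolding Inn_def by blast
  obtain D T where e: "finite T" "e = (\<lambda>x. \<Sum>g\<in>T. scale (D g) (ad (Poly_Mapping.single g 1) x))"
    using assms(2) unfolding Inn_def by blast
  define E where "E g = (if g \<in> S then C g else 0) + (if g \<in> T then D g else 0)" for g
  have z: "scale 0 y = 0" for y :: "('a, 'g) group_ring"
    by (rule poly_mapping_eqI) (simp add: lookup_scale)
  have 1: "(\<Sum>g\<in>S. scale (C g) (ad (Poly_Mapping.single g 1) x)) =
      (\<Sum>g\<in>S \<union> T. scale (if g \<in> S then C g else 0) (ad (Poly_Mapping.single g 1) x))" for x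
    by (rule sum.mono_neutral_cong_left) (auto simp: d(1) e(1) z)
  have 2: "(\<Sum>g\<in>T. scale (D g) (ad (Poly_Mapping.single g 1) x)) =
      (\<Sum>g\<in>S \<union> T. scale (if g \<in> T then D g else 0) (ad (Poly_Mapping.single g 1) x))" for x
    by (rule sum.mono_neutral_cong_left) (auto simp: d(1) e(1) z)
  have "(\<lambda>x. d x + e x) = (\<lambda>x. \<Sum>g\<in>S \<union> T. scale (E g) (ad (Poly_Mapping.single g 1) x))"
    by (simp add: d(2) e(2) 1 2 E_def scale_add_left sum.distrib)
  then show ?thesis
    unfolding Inn_def using d(1) e(1) by blast
qed

lemma Inn_uminus:
  assumes "d \<in> Inn"
  shows "(\<lambda>x. - d x) \<in> Inn"
proof -
  obtain C S where d: "finite S" "d = (\<lambda>x. \<Sum>g\<in>S. scale (C g) (ad (Poly_Mapping.single g 1) x))"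
    using assms unfolding Inn_def by blast
  have "(\<lambda>x. - d x) = (\<lambda>x. \<Sum>g\<in>S. scale (- C g) (ad (Poly_Mapping.single g 1) x))"
    by (simp add: d(2) scale_minus_left sum_negf)
  then show ?thesis
    unfolding Inn_def using d(1) by (intro CollectI exI[of _ "\<lambda>g. - C g"] exI[of _ S]) simp
qed

lemma subgroup_Inn:
  "subgroup (Inn :: (('a::{comm_ring, monoid_mult}, 'g::group_add) group_ring \<Rightarrow> _) set) Der_group"
proof -
  interpret comm_group "Der_group :: (('a, 'g) group_ring \<Rightarrow> _) monoid"
    by (rule comm_group_Der_group)
  have sub: "Inn \<subseteq> (Der :: (('a, 'g) group_ring \<Rightarrow> _) set)"
    unfolding Inn_def by (auto intro!: sum_in_Der scale_in_Der ad_in_Der)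
  show "subgroup (Inn :: (('a, 'g) group_ring \<Rightarrow> _) set) Der_group"
  proof (rule subgroupI)
    show "(Inn :: (('a, 'g) group_ring \<Rightarrow> _) set) \<noteq> {}"
      unfolding Inn_def by blast
    fix d :: "('a, 'g) group_ring \<Rightarrow> ('a, 'g) group_ring" assume d: "d \<in> Inn"
    have "inv\<^bsub>Der_group\<^esub> d = (\<lambda>x. - d x)"
      using d Inn_uminus[OF d] sub
      by (intro inv_equality) (auto simp: Der_group_def)
    then show "inv\<^bsub>Der_group\<^esub> d \<in> Inn"
      using Inn_uminus[OF d] by simp
  qed (use sub in \<open>auto simp: Der_group_def Inn_add\<close>)
qed

lemma group_Out: "group (Out TYPE('a::{comm_ring, monoid_mult}) TYPE('g::group_add))"
  unfolding Out_def
  by (intro normal.factorgroup_is_group comm_group.normal_iff_subgroup[THEN iffD2]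
      comm_group_Der_group subgroup_Inn)

end

theory Submission
  imports Defs
begin

text \<open>
  For a derivation \<open>d\<close> let \<open>D g\<close> be the function \<open>k \<mapsto> coefficient of d(g) g\<^sup>-\<^sup>1 at k\<close>. The product rule
  makes \<open>D\<close> a 1-cocycle of \<open>G\<close> acting by conjugation on functions. On the centralizer of \<open>k\<close>,
  \<open>z \<mapsto> D z k\<close> is a homomorphism from a finite group to a torsion-free one, hence zero. So the value
  of \<open>D t\<close> at \<open>t r t\<^sup>-\<^sup>1\<close> depends only on the conjugate \<open>t r t\<^sup>-\<^sup>1\<close>, and choosing one
  representative \<open>r\<close> per conjugacy class gives a function \<open>a\<close> on \<open>G\<close> whose coboundary is \<open>D\<close>. No
  division by the order of \<open>G\<close> occurs, and \<open>d\<close> is the inner derivation of \<open>a\<close>.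
\<close>

lemma lookup_times_single_one:
  fixes x :: "('a::{comm_ring, monoid_mult}, 'g::group_add) group_ring"
  shows "Poly_Mapping.lookup (x * Poly_Mapping.single h 1) m = Poly_Mapping.lookup x (m - h)"
proof -
  have "(\<Sum>q. (1 when h = q) when m = l + q) = ((1::'a) when l = m - h)" for l
  proof -
    have "(((1::'a) when h = q) when m = l + q) = ((1 when l = m - h) when q = h)" for q
      by (auto simp: when_def)
    then show ?thesis by simp
  qed
  then show ?thesis
    by (simp add: lookup_mult lookup_single mult_when)
qed

lemma lookup_single_one_times:
  fixes x :: "('a::{comm_ring, monoid_mult}, 'g::group_add) group_ring"
  shows "Poly_Mapping.lookup (Poly_Mapping.single g 1 * x) m = Poly_Mapping.lookup x (- g + m)"
proof -
  have *: "m = g + q \<longleftrightarrow> q = - g + m" for q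
    by (metis add.assoc add.left_inverse add.right_inverse add_0)
  show ?thesis
    by (simp add: lookup_mult lookup_single when_mult *)
qed

lemma poly_mapping_eq_sum_single:
  fixes x :: "('a::{comm_ring, monoid_mult}, 'g::{group_add, finite}) group_ring"
  shows "x = (\<Sum>g\<in>UNIV. scale (Poly_Mapping.lookup x g) (Poly_Mapping.single g 1))"
  by (rule poly_mapping_eqI)
     (simp add: lookup_sum lookup_scale lookup_single when_def if_distrib cong: if_cong)

lemma Der_eqI:
  fixes d e :: "('a::{comm_ring, monoid_mult}, 'g::{group_add, finite}) group_ring \<Rightarrow> _"
  assumes "d \<in> Der" "e \<in> Der"
    and single: "\<And>g. d (Poly_Mapping.single g 1) = e (Poly_Mapping.single g 1)"
  shows "d = e"
proof
  have expand: "f x = (\<Sum>g\<in>UNIV. scale (Poly_Mapping.lookup x g) (f (Poly_Mapping.single g 1)))"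
    if f: "f \<in> Der" for f :: "('a, 'g) group_ring \<Rightarrow> ('a, 'g) group_ring" and x
  proof -
    have add: "f (x + y) = f x + f y" and scale: "f (scale c x) = scale c (f x)" for x y c
      using f by (simp_all add: Der_def)
    have "f 0 = 0"
      using add[of 0 0] by simp
    then have "f (\<Sum>g\<in>S. h g) = (\<Sum>g\<in>S. f (h g))" for S :: "'g set" and h
      by (induction S rule: infinite_finite_induct) (simp_all add: add)
    then show ?thesis
      by (subst poly_mapping_eq_sum_single[of x]) (simp add: scale)
  qed
  fix x show "d x = e x"
    by (simp add: expand[OF assms(1), of x] expand[OF assms(2), of x] single)
qed

text \<open>\<open>ad\<close> is linear in its index, so the coefficients of \<open>a\<close> serve
  as the family \<open>C\<close>; since the group is finite, all of \<open>UNIV\<close> serves as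
  \<open>S\<close>.\<close>

lemma ad_in_Inn:
  fixes a :: "('a::{comm_ring, monoid_mult}, 'g::{group_add, finite}) group_ring"
  shows "ad a \<in> Inn"
proof -
  have "ad a = (\<lambda>x. \<Sum>g\<in>UNIV. scale (Poly_Mapping.lookup a g) (ad (Poly_Mapping.single g 1) x))"
  proof
    fix x
    show "ad a x = (\<Sum>g\<in>UNIV. scale (Poly_Mapping.lookup a g) (ad (Poly_Mapping.single g 1) x))"
      unfolding ad_def
      by (subst (1 2) poly_mapping_eq_sum_single[of a])
         (simp add: sum_distrib_left sum_distrib_right scale_mult_left scale_mult_right
           scale_diff_right sum_subtractf)
  qed
  then show ?thesis
    unfolding Inn_def
    by (intro CollectI exI[of _ "Poly_Mapping.lookup a"] exI[of _ UNIV] conjI) simp_all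
qed

lemma cocycle_vanishes_on_centralizer:
  fixes D :: "'g::{group_add, finite} \<Rightarrow> 'g \<Rightarrow> 'a::ab_group_add"
  assumes tf: "torsion_free TYPE('a)"
    and cocycle: "\<And>g h k. D (g + h) k = D g k + D h (- g + k + g)"
    and z: "- z + k + z = k"
  shows "D z k = 0"
proof -
  \<comment> \<open>The n-th power of \<open>z\<close>, written additively. Each power fixes
    \<open>k\<close> under conjugation, so the cocycle rule is additive along these powers.\<close>
  define p where "p n = ((+) z ^^ n) 0" for n
  have step: "D (p (i + m)) k = D (p i) k + (\<Sum>j<m. D z k)" for i m
  proof (induction m)
    case (Suc m)
    have "D (p (i + Suc m)) k = D z k + D (p (i + m)) k"
      by (simp add: p_def cocycle[of z] z)
    with Suc show ?case
      by (simp add: add.commute add.left_commute)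
  qed simp
  have "\<not> inj p"
    using finite_imageD[of p UNIV] by auto
  \<comment> \<open>Two coinciding powers suffice: cancelling \<open>D (p i) k\<close> in
    \<open>step\<close> leaves a positive multiple of \<open>D z k\<close> equal to zero.\<close>
  then obtain i j where "p i = p j" "i < j"
    unfolding inj_def by (metis linorder_neqE_nat)
  with step[of i "j - i"] have "(\<Sum>l<j - i. D z k) = 0" "j - i > 0"
    by simp_all
  with tf show ?thesis
    unfolding torsion_free_def by blast
qed

lemma cocycle_is_coboundary:
  fixes D :: "'g::{group_add, finite} \<Rightarrow> 'g \<Rightarrow> 'a::ab_group_add"
  assumes tf: "torsion_free TYPE('a)"
    and cocycle: "\<And>g h k. D (g + h) k = D g k + D h (- g + k + g)"
  obtains a where "\<And>g k. D g k = a k - a (- g + k + g)"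
proof -
  have D_conj: "D s k = D t k" if "- s + k + s = - t + k + t" for s t k
  proof -
    \<comment> \<open>\<open>- t + s\<close> centralizes the common conjugate, so the second term of
      the cocycle rule for \<open>s = t + (- t + s)\<close> vanishes.\<close>
    have "- (- t + s) + (- t + k + t) + (- t + s) = - t + k + t"
      using that by (simp only: minus_add minus_minus add.assoc add_minus_cancel minus_add_cancel)
    from cocycle_vanishes_on_centralizer[OF tf cocycle this]
    show ?thesis
      using cocycle[of t "- t + s" k] by (simp flip: add.assoc)
  qed
  define rep where "rep k = (SOME r. \<exists>t. r = - t + k + t)" for k :: 'g
  have "\<exists>t. rep k = - t + k + t" for k
    unfolding rep_def by (rule someI_ex) blast
  then obtain t where t: "rep k = - t k + k + t k" for k
    by metis
  have rep_conj: "rep (- g + k + g) = rep k" for g k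
  proof -
    \<comment> \<open>Conjugate elements give \<open>SOME\<close> the same predicate, hence the same
      choice; the witnesses differ by a left translation by \<open>g\<close>.\<close>
    have "(\<exists>s. r = - s + (- g + k + g) + s) \<longleftrightarrow> (\<exists>s. r = - s + k + s)" for r
    proof
      assume "\<exists>s. r = - s + (- g + k + g) + s"
      then obtain s where "r = - s + (- g + k + g) + s" ..
      then have "r = - (g + s) + k + (g + s)"
        by (simp only: minus_add add.assoc)
      then show "\<exists>s. r = - s + k + s" ..
    next
      assume "\<exists>s. r = - s + k + s"
      then obtain s where "r = - s + k + s" ..
      then have "r = - (- g + s) + (- g + k + g) + (- g + s)"
        by (simp only: minus_add minus_minus add.assoc add_minus_cancel minus_add_cancel)
      then show "\<exists>s. r = - s + (- g + k + g) + s" ..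
    qed
    then show ?thesis
      by (simp add: rep_def)
  qed
  have "D g k = D (t k) k - D (t (- g + k + g)) (- g + k + g)" for g k
  proof -
    let ?k = "- g + k + g"
    \<comment> \<open>Both \<open>t k\<close> and \<open>g + t ?k\<close> carry \<open>k\<close> to
      its representative, so \<open>D\<close> agrees on them at \<open>k\<close>; the cocycle rule
      then splits off \<open>D g k\<close>.\<close>
    have "- (g + t ?k) + k + (g + t ?k) = - t k + k + t k"
      using t[of k] t[of ?k] rep_conj[of g k] by (simp only: minus_add add.assoc)
    then have "D (t k) k = D (g + t ?k) k"
      by (metis D_conj)
    then show ?thesis
      by (simp add: cocycle)
  qed
  then show thesis
    using that[of "\<lambda>k. D (t k) k"] by blast
qed

lemma Der_subset_Inn:
  assumes tf: "torsion_free TYPE('a::{comm_ring, monoid_mult})"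
  shows "(Der :: (('a, 'g::{group_add, finite}) group_ring \<Rightarrow> _) set) \<subseteq> Inn"
proof
  fix d :: "('a, 'g) group_ring \<Rightarrow> ('a, 'g) group_ring"
  assume d: "d \<in> Der"
  define D where "D g k = Poly_Mapping.lookup (d (Poly_Mapping.single g 1)) (k + g)" for g k
  have "D (g + h) k = D g k + D h (- g + k + g)" for g h k
  proof -
    \<comment> \<open>The cocycle rule is this identity read at the coefficient
      \<open>k + g + h\<close>.\<close>
    have "d (Poly_Mapping.single g 1 * Poly_Mapping.single h 1) =
        d (Poly_Mapping.single g 1) * Poly_Mapping.single h 1 +
        Poly_Mapping.single g 1 * d (Poly_Mapping.single h 1)"
      using d unfolding Der_def by blast
    then show ?thesis
      by (simp add: mult_single D_def lookup_add lookup_times_single_one lookup_single_one_times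
          add_diff_eq flip: add.assoc)
  qed
  from cocycle_is_coboundary[OF tf this]
  obtain a where a: "D g k = a k - a (- g + k + g)" for g k
    by blast
  \<comment> \<open>Any function on a finite group has finite support, so \<open>a\<close> is an
    element of the group ring.\<close>
  define b :: "('a, 'g) group_ring" where "b = Abs_poly_mapping a"
  have b: "Poly_Mapping.lookup b = a"
    unfolding b_def by (rule Abs_poly_mapping_inverse) simp
  have "d = ad b"
  proof (rule Der_eqI[OF d ad_in_Der], rule poly_mapping_eqI)
    fix g k
    show "Poly_Mapping.lookup (d (Poly_Mapping.single g 1)) k =
        Poly_Mapping.lookup (ad b (Poly_Mapping.single g 1)) k"
      \<comment> \<open>The shift by \<open>g\<close> undoes the one in \<open>D\<close>: both sides
        become \<open>a (k - g) - a (- g + k)\<close>.\<close>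
      using a[of g "k - g"]
      by (simp add: D_def ad_def lookup_minus lookup_times_single_one lookup_single_one_times b
          add.assoc)
  qed
  then show "d \<in> Inn"
    by (simp add: ad_in_Inn)
qed

lemma trivial_group_Out:
  assumes "torsion_free TYPE('a::{comm_ring, monoid_mult})"
  shows "trivial_group (Out TYPE('a) TYPE('g::{group_add, finite}))"
proof -
  let ?G = "Der_group :: (('a, 'g) group_ring \<Rightarrow> _) monoid"
  interpret comm_group ?G
    by (rule comm_group_Der_group)
  have "Inn = carrier ?G"
    using subgroup.subset[OF subgroup_Inn] Der_subset_Inn[OF assms] by (auto simp: Der_group_def)
  moreover have "rcosets\<^bsub>?G\<^esub> (carrier ?G) = {carrier ?G}"
    unfolding RCOSETS_def using coset_join2[OF _ subgroup_self] by fastforce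
  ultimately show ?thesis
    using group_Out[where 'a='a and 'g='g]
    by (simp add: trivial_group_def Out_def FactGroup_def)
qed

text \<open>The n-fold sum is \<open>of_nat n * a\<close>, a product in a domain whose first factor
  is nonzero for positive n.\<close>

lemma torsion_free_char_0: "torsion_free TYPE('a::{idom, ring_char_0})"
  by (simp add: torsion_free_def)

theorem corollary4p2p4:
  shows "(torsion_free TYPE('a::{comm_ring, monoid_mult}) \<longrightarrow>
            trivial_group (Out TYPE('a) TYPE('g::{group_add, finite}))) \<and>
         trivial_group (Out TYPE(int) TYPE('g)) \<and>
         trivial_group (Out TYPE(rat) TYPE('g)) \<and>
         trivial_group (Out TYPE(real) TYPE('g)) \<and>
         trivial_group (Out TYPE(complex) TYPE('g))"
  by (intro conjI impI trivial_group_Out torsion_free_char_0)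

end
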